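(* Let $R$ be a principal ideal domain with field of fractions $K$, let $1\le k\le n$, and let $\psi:\mathcal{A}_{k,n}\to K$ be a specialization of $\mathcal{A}_{k,n}$ such that $\psi(t_{i_1,\ldots,i_k})\in R\setminus\{0\}$ for all $1\le i_1<\cdots<i_k\le n$. Then $\psi$ has a representation $X\in R^{k\times n}$, i.e. there is a matrix $X\in R^{k\times n}$ such that for all $1\le i_1<\cdots<i_k\le n$, the determinant of the $k\times k$ submatrix of $X$ formed by the columns $i_1,\ldots,i_k$ equals $\psi(t_{i_1,\ldots,i_k})$.
   Context: Let $K$ be a field. Let $P=K[x_{i,j}\mid 1\le i\le k,\ 1\le j\le n]$ be the polynomial ring in the entries of a generic $k\times n$ matrix $X$, and $T=K[t_{i_1,\ldots,i_k}\mid 1\le i_1<\cdots<i_k\le n]$. Let $p:T\to P$ be the $K$-algebra homomorphism sending $t_{i_1,\ldots,i_k}$ to the determinant of the submatrix of $X$ formed by columns $i_1,\ldots,i_k$. Then $\mathcal{A}_{k,n}:=T/\ker(p)$ (the homogeneous coordinate ring of the Grassmannian $\mathrm{Gr}(k,n)$), and $t_{i_1,\ldots,i_k}$ also denotes its image in $\mathcal{A}_{k,n}$. A specialization of $\mathcal{A}_{k,n}$ is a $K$-algebra homomorphism $\psi:\mathcal{A}_{k,n}\to K$ (equivalently, an assignment of values in $K$ to the $t_{i_1,\ldots,i_k}$ satisfying every polynomial relation holding among the maximal minors of a generic $k\times n$ matrix). *)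

theory Defs
  imports
    "HOL-Library.Poly_Mapping"
    "HOL-Algebra.Algebraic_Closure_Type"
    "HOL-Algebra.QuotRing"
    "HOL-Algebra.Ring_Divisibility"
    "Jordan_Normal_Form.Determinant"
begin

text \<open>
  Polynomials are finitely supported maps from monomials (finitely supported exponent vectors)
  to coefficients. The ring of polynomials in the variables \<open>V\<close> is the subring
  of those polynomials that only involve variables from \<open>V\<close>.
\<close>

type_synonym ('v, 'a) mpoly = "('v \<Rightarrow>\<^sub>0 nat) \<Rightarrow>\<^sub>0 'a"

definition Const :: "'a::comm_ring_1 \<Rightarrow> ('v, 'a) mpoly" where
  "Const c = Poly_Mapping.single 0 c"

definition Var :: "'v \<Rightarrow> ('v, 'a::comm_ring_1) mpoly" where
  "Var v = Poly_Mapping.single (Poly_Mapping.single v 1) 1"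

definition mpoly_ring :: "'v set \<Rightarrow> ('v, 'a::comm_ring_1) mpoly ring" where
  "mpoly_ring V =
     ring_of_type_algebra\<lparr>carrier := {f. \<forall>m \<in> Poly_Mapping.keys f. Poly_Mapping.keys m \<subseteq> V}\<rparr>"

definition mpoly_subst ::
    "('v \<Rightarrow> ('w, 'a) mpoly) \<Rightarrow> ('v, 'a::comm_ring_1) mpoly \<Rightarrow> ('w, 'a) mpoly" where
  "mpoly_subst g f =
     (\<Sum>m \<in> Poly_Mapping.keys f. Const (Poly_Mapping.lookup f m) *
        (\<Prod>v \<in> Poly_Mapping.keys m. g v ^ Poly_Mapping.lookup m v))"

lemma mpoly_ring_simps [simp]:
  "carrier (mpoly_ring V) = {f. \<forall>m \<in> Poly_Mapping.keys f. Poly_Mapping.keys m \<subseteq> V}"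
  "add (mpoly_ring V) = (+)" "monoid.mult (mpoly_ring V) = (*)"
  "\<zero>\<^bsub>mpoly_ring V\<^esub> = 0" "\<one>\<^bsub>mpoly_ring V\<^esub> = 1"
  by (auto simp: mpoly_ring_def ring_of_type_algebra_def)

lemma Const_simps: "Const 0 = 0" "Const 1 = 1" "Const (a + b) = Const a + Const b"
  "Const (a * b) = Const a * Const b"
  by (simp_all add: Const_def single_add mult_single)

lemma mpoly_ring_carrier_closed:
  "Const c \<in> carrier (mpoly_ring V)"
  "v \<in> V \<Longrightarrow> Var v \<in> carrier (mpoly_ring V)"
  "f \<in> carrier (mpoly_ring V) \<Longrightarrow> g \<in> carrier (mpoly_ring V) \<Longrightarrow> f + g \<in> carrier (mpoly_ring V)"
  "f \<in> carrier (mpoly_ring V) \<Longrightarrow> g \<in> carrier (mpoly_ring V) \<Longrightarrow> f * g \<in> carrier (mpoly_ring V)"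
  "f \<in> carrier (mpoly_ring V) \<Longrightarrow> - f \<in> carrier (mpoly_ring V)"
proof -
  show "Const c \<in> carrier (mpoly_ring V)" by (simp add: Const_def)
  show "v \<in> V \<Longrightarrow> Var v \<in> carrier (mpoly_ring V)" by (simp add: Var_def)
  show "f \<in> carrier (mpoly_ring V) \<Longrightarrow> g \<in> carrier (mpoly_ring V) \<Longrightarrow> f + g \<in> carrier (mpoly_ring V)"
    using Poly_Mapping.keys_add[of f g] by fastforce
  show "f \<in> carrier (mpoly_ring V) \<Longrightarrow> - f \<in> carrier (mpoly_ring V)"
    by (simp add: in_keys_iff)
  show "f * g \<in> carrier (mpoly_ring V)"
    if f: "f \<in> carrier (mpoly_ring V)" and g: "g \<in> carrier (mpoly_ring V)"
  proof -
    have "Poly_Mapping.keys m \<subseteq> V" if m: "m \<in> Poly_Mapping.keys (f * g)" for m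
    proof -
      obtain a b where "m = a + b" "a \<in> Poly_Mapping.keys f" "b \<in> Poly_Mapping.keys g"
        using m Poly_Mapping.keys_mult[of f g] by auto
      thus ?thesis using f g Poly_Mapping.keys_add[of a b] by fastforce
    qed
    thus ?thesis by simp
  qed
qed

lemma cring_mpoly_ring: "cring (mpoly_ring V :: ('v, 'a::comm_ring_1) mpoly ring)"
proof (rule cringI)
  let ?P = "mpoly_ring V :: ('v, 'a) mpoly ring"
  note cl = mpoly_ring_carrier_closed[of _ V]
  have z: "0 \<in> carrier ?P" by simp
  have o: "1 \<in> carrier ?P" using cl(1)[of 1] by (simp add: Const_simps)
  show "abelian_group ?P"
  proof (rule abelian_groupI)
    fix f assume "f \<in> carrier ?P"
    thus "\<exists>g \<in> carrier ?P. g \<oplus>\<^bsub>?P\<^esub> f = \<zero>\<^bsub>?P\<^esub>"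
      using mpoly_ring_carrier_closed(5)[of f V] by (intro bexI[of _ "- f"]) simp_all
  qed (use z mpoly_ring_carrier_closed(3) in \<open>simp_all add: algebra_simps\<close>)
  show "comm_monoid ?P"
    by (rule comm_monoidI) (use o mpoly_ring_carrier_closed(4) in \<open>simp_all add: algebra_simps\<close>)
qed (simp add: algebra_simps)

definition mpoly_subst_monom where
  "mpoly_subst_monom g m = (\<Prod>v \<in> Poly_Mapping.keys m. g v ^ Poly_Mapping.lookup m v)"

lemma mpoly_subst_monom_superset:
  "finite A \<Longrightarrow> Poly_Mapping.keys m \<subseteq> A \<Longrightarrow>
     mpoly_subst_monom g m = (\<Prod>v \<in> A. (g v :: 'b::comm_ring_1) ^ Poly_Mapping.lookup m v)"
  unfolding mpoly_subst_monom_def by (rule prod.mono_neutral_left) (auto simp: in_keys_iff)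

lemma mpoly_subst_monom_add: "mpoly_subst_monom g (a + b) = (mpoly_subst_monom g a * mpoly_subst_monom g b :: 'b::comm_ring_1)"
proof -
  let ?A = "Poly_Mapping.keys a \<union> Poly_Mapping.keys b"
  have "finite ?A" by simp
  thus ?thesis using Poly_Mapping.keys_add[of a b]
    by (simp add: mpoly_subst_monom_superset[of ?A] lookup_add power_add prod.distrib)
qed

lemma mpoly_subst_superset:
  "finite A \<Longrightarrow> Poly_Mapping.keys f \<subseteq> A \<Longrightarrow>
     mpoly_subst g f = (\<Sum>m \<in> A. Const (Poly_Mapping.lookup f m) * mpoly_subst_monom g m)"
  unfolding mpoly_subst_def mpoly_subst_monom_def
  by (rule sum.mono_neutral_left) (auto simp: in_keys_iff Const_simps)

lemma mpoly_subst_add: "mpoly_subst g (f + h) = mpoly_subst g f + mpoly_subst g h"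
proof -
  let ?A = "Poly_Mapping.keys f \<union> Poly_Mapping.keys h"
  have "finite ?A" by simp
  thus ?thesis using Poly_Mapping.keys_add[of f h]
    by (simp add: mpoly_subst_superset[of ?A] lookup_add Const_simps distrib_right sum.distrib)
qed

lemma mpoly_subst_single: "mpoly_subst g (Poly_Mapping.single m c) = Const c * mpoly_subst_monom g m"
  by (subst mpoly_subst_superset[of "{m}"]) (auto split: if_splits)

lemma mpoly_subst_zero: "mpoly_subst g 0 = 0" by (simp add: mpoly_subst_def)

lemma mpoly_induct [case_names zero add]:
  assumes "P 0" "\<And>m c f. P f \<Longrightarrow> P (Poly_Mapping.single m c + f)"
  shows "P (f :: ('v, 'a::comm_ring_1) mpoly)"
proof (induction f rule: Poly_Mapping.update_induct)
  case (update f a b)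
  have "Poly_Mapping.update a b f = Poly_Mapping.single a b + f"
    using update(1)
    by (intro poly_mapping_eqI) (auto simp: lookup_add lookup_update lookup_single in_keys_iff when_def)
  thus ?case using assms(2) update by simp
qed (rule assms)

lemma mpoly_subst_mult: "mpoly_subst g (f * h) = mpoly_subst g f * mpoly_subst g h"
proof (induction f rule: mpoly_induct)
  case (add m c f)
  have "mpoly_subst g (Poly_Mapping.single m c * h) = mpoly_subst g (Poly_Mapping.single m c) * mpoly_subst g h"
    by (induction h rule: mpoly_induct)
       (simp_all add: mpoly_subst_zero mpoly_subst_add distrib_left mult_single mpoly_subst_single mpoly_subst_monom_add
         Const_simps mult_ac)
  thus ?case using add by (simp add: distrib_right mpoly_subst_add)
qed (simp add: mpoly_subst_zero)

lemma mpoly_subst_Const: "mpoly_subst g (Const c) = Const c"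
  by (simp add: Const_def mpoly_subst_single[unfolded Const_def] mpoly_subst_monom_def)

lemma mpoly_subst_Var: "mpoly_subst g (Var v) = g v"
  by (simp add: Var_def mpoly_subst_single Const_simps mpoly_subst_monom_def)


lemma mpoly_ring_sum_closed:
  "(\<And>i. i \<in> A \<Longrightarrow> f i \<in> carrier (mpoly_ring V)) \<Longrightarrow> sum f A \<in> carrier (mpoly_ring V)"
  by (induction A rule: infinite_finite_induct)
     (simp_all add: mpoly_ring_carrier_closed(3) del: mpoly_ring_simps(1), simp_all)

lemma mpoly_ring_prod_closed:
  "(\<And>i. i \<in> A \<Longrightarrow> f i \<in> carrier (mpoly_ring V)) \<Longrightarrow> prod f A \<in> carrier (mpoly_ring V)"
proof (induction A rule: infinite_finite_induct)
  case (insert x F)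
  thus ?case using mpoly_ring_carrier_closed(4)[of "f x" V "prod f F"] by (simp del: mpoly_ring_simps(1))
qed (simp_all add: Const_def)

lemma mpoly_ring_power_closed:
  "f \<in> carrier (mpoly_ring V) \<Longrightarrow> f ^ e \<in> carrier (mpoly_ring V)"
  using mpoly_ring_prod_closed[of "{..<e}" "\<lambda>_. f" V] by (simp del: mpoly_ring_simps(1))

lemma mpoly_subst_closed:
  assumes "f \<in> carrier (mpoly_ring V)" "\<And>v. v \<in> V \<Longrightarrow> g v \<in> carrier (mpoly_ring W)"
  shows "mpoly_subst g f \<in> carrier (mpoly_ring W)"
  unfolding mpoly_subst_def
  by (intro mpoly_ring_sum_closed mpoly_ring_carrier_closed(1,4) mpoly_ring_prod_closed
      mpoly_ring_power_closed assms(2)) (use assms(1) in auto)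

text \<open>
  Rows and columns are numbered from \<open>0\<close>, as in the matrix library. A choice of columns
  \<open>i\<^sub>1 < \<dots> < i\<^sub>k\<close> is a strictly increasing list.
\<close>

definition col_choices :: "nat \<Rightarrow> nat \<Rightarrow> nat list set" where
  "col_choices k n = {js. length js = k \<and> sorted_wrt (<) js \<and> set js \<subseteq> {0..<n}}"

definition col_submatrix :: "'a mat \<Rightarrow> nat list \<Rightarrow> 'a mat" where
  "col_submatrix M js = mat_of_cols (dim_row M) (map (col M) js)"

definition generic_mat :: "nat \<Rightarrow> nat \<Rightarrow> (nat \<times> nat, 'a::comm_ring_1) mpoly mat" where
  "generic_mat k n = mat k n Var"

definition minor_map ::
    "nat \<Rightarrow> nat \<Rightarrow> (nat list, 'a::comm_ring_1) mpoly \<Rightarrow> (nat \<times> nat, 'a) mpoly" where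
  "minor_map k n = mpoly_subst (\<lambda>js. det (col_submatrix (generic_mat k n) js))"

definition minor_relations :: "nat \<Rightarrow> nat \<Rightarrow> (nat list, 'a::comm_ring_1) mpoly set" where
  "minor_relations k n =
     a_kernel (mpoly_ring (col_choices k n)) (mpoly_ring ({0..<k} \<times> {0..<n})) (minor_map k n)"

definition grassmann_ring :: "nat \<Rightarrow> nat \<Rightarrow> (nat list, 'a::comm_ring_1) mpoly set ring" where
  "grassmann_ring k n = mpoly_ring (col_choices k n) Quot minor_relations k n"

definition residue_class ::
    "nat \<Rightarrow> nat \<Rightarrow> (nat list, 'a::comm_ring_1) mpoly \<Rightarrow> (nat list, 'a) mpoly set" where
  "residue_class k n f = minor_relations k n +>\<^bsub>mpoly_ring (col_choices k n)\<^esub> f"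

definition plucker_coord :: "nat \<Rightarrow> nat \<Rightarrow> nat list \<Rightarrow> (nat list, 'a::comm_ring_1) mpoly set" where
  "plucker_coord k n js = residue_class k n (Var js)"

lemma generic_minor_closed:
  assumes "js \<in> col_choices k n"
  shows "det (col_submatrix (generic_mat k n) js)
           \<in> carrier (mpoly_ring ({0..<k} \<times> {0..<n}) :: (nat \<times> nat, 'a::comm_ring_1) mpoly ring)"
proof -
  let ?P = "mpoly_ring ({0..<k} \<times> {0..<n}) :: (nat \<times> nat, 'a) mpoly ring"
  let ?S = "col_submatrix (generic_mat k n) js :: (nat \<times> nat, 'a) mpoly mat"
  have S: "?S \<in> carrier_mat k k"
    using assms by (auto simp: col_submatrix_def generic_mat_def col_choices_def)
  have ent: "?S $$ (i, j) \<in> carrier ?P" if "i < k" "j < k" for i j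
  proof -
    have "js ! j < n" using assms that nth_mem[of j js] by (auto simp: col_choices_def simp del: nth_mem)
    hence "?S $$ (i, j) = Var (i, js ! j)"
      using assms that
      by (simp add: col_submatrix_def generic_mat_def col_choices_def mat_of_cols_index)
    thus ?thesis using that \<open>js ! j < n\<close> by (simp add: Var_def)
  qed
  have sg: "signof p \<in> carrier ?P" for p :: "nat \<Rightarrow> nat"
  proof -
    have "signof p = (1 :: (nat \<times> nat, 'a) mpoly) \<or> signof p = - (1 :: (nat \<times> nat, 'a) mpoly)"
      by (auto simp: sign_def)
    thus ?thesis
      using mpoly_ring_carrier_closed(1)[of 1] mpoly_ring_carrier_closed(5)[of 1]
      unfolding Const_simps by metis
  qed
  show ?thesis unfolding det_def'[OF S]
    by (intro mpoly_ring_sum_closed mpoly_ring_carrier_closed(4) sg mpoly_ring_prod_closed ent)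
       (auto dest: permutes_in_image)
qed

lemma minor_map_hom:
  "minor_map k n \<in> Ring.ring_hom (mpoly_ring (col_choices k n))
     (mpoly_ring ({0..<k} \<times> {0..<n}) :: (nat \<times> nat, 'a::comm_ring_1) mpoly ring)"
  unfolding minor_map_def
  by (rule ring_hom_memI)
     (use mpoly_subst_Const[of _ 1] in \<open>simp_all add: mpoly_subst_add mpoly_subst_mult Const_simps mpoly_subst_closed
        generic_minor_closed del: mpoly_ring_simps(1)\<close>)

lemma minor_relations_ideal:
  "ideal (minor_relations k n) (mpoly_ring (col_choices k n) :: (nat list, 'a::comm_ring_1) mpoly ring)"
  unfolding minor_relations_def
  by (intro ring_hom_ring.kernel_is_ideal ring_hom_ringI2 cring.axioms(1) cring_mpoly_ring minor_map_hom)

lemma cring_grassmann_ring: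
  "cring (grassmann_ring k n :: (nat list, 'a::comm_ring_1) mpoly set ring)"
  unfolding grassmann_ring_def
  by (rule ideal.quotient_is_cring[OF minor_relations_ideal cring_mpoly_ring])

text \<open>
  A ring homomorphism from the Grassmann ring to the base field is a homomorphism of algebras
  over the field iff it fixes the constants.
\<close>

definition specialization ::
    "nat \<Rightarrow> nat \<Rightarrow> ((nat list, 'a::field) mpoly set \<Rightarrow> 'a) \<Rightarrow> bool" where
  "specialization k n \<psi> \<longleftrightarrow>
     \<psi> \<in> Ring.ring_hom (grassmann_ring k n) ring_of_type_algebra \<and>
     (\<forall>c. \<psi> (residue_class k n (Const c)) = c)"

text \<open>
  A principal ideal domain together with its field of fractions, the domain being regarded as a
  subring of the field.
\<close>

definition pid_with_fraction_field :: "'a::field set \<Rightarrow> bool" where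
  "pid_with_fraction_field R \<longleftrightarrow>
     principal_domain (ring_of_type_algebra\<lparr>carrier := R\<rparr>) \<and>
     (\<forall>x. \<exists>a \<in> R. \<exists>b \<in> R - {0}. x = a / b)"

definition represents :: "nat \<Rightarrow> nat \<Rightarrow> 'a::field mat \<Rightarrow>
    ((nat list, 'a) mpoly set \<Rightarrow> 'a) \<Rightarrow> bool" where
  "represents k n M \<psi> \<longleftrightarrow>
     M \<in> carrier_mat k n \<and>
     (\<forall>js \<in> col_choices k n. det (col_submatrix M js) = \<psi> (plucker_coord k n js))"

end

theory Submission
  imports Defs
begin

text \<open>
  Over the fraction field, Cramer's rule reconstructs a matrix from its maximal minors: the entries
  of \<open>adj(X\<^sub>0) X\<close>, where \<open>X\<^sub>0\<close> consists of the first \<open>k\<close> columns of the generic matrix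
  \<open>X\<close>, are up to sign maximal minors of \<open>X\<close>, so \<open>\<psi>\<close> turns this matrix into a
  matrix which, after rescaling one row, is a representation \<open>A\<close> of \<open>\<psi>\<close> over the field. The
  columns of \<open>A\<close> span a free \<open>R\<close>-module of rank at most \<open>k\<close>, which
  gives \<open>A = (A U) V\<close> with matrices \<open>U\<close> and \<open>V\<close> over \<open>R\<close>. By multilinearity
  \<open>det (A U)\<close> is an \<open>R\<close>-linear combination of maximal minors of \<open>A\<close>, hence lies in
  \<open>R\<close>, and multiplying one row of \<open>V\<close> by it gives the desired matrix.
\<close>

section \<open>Column submatrices\<close>

lemma col_submatrix_carrier [simp]:
  "M \<in> carrier_mat k n \<Longrightarrow> length js = m \<Longrightarrow> col_submatrix M js \<in> carrier_mat k m"
  by (auto simp: col_submatrix_def)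

lemma col_submatrix_index:
  assumes "M \<in> carrier_mat k n" "set js \<subseteq> {0..<n}" "i < k" "j < length js"
  shows "col_submatrix M js $$ (i, j) = M $$ (i, js ! j)"
proof -
  have "js ! j < n" using assms(2,4) nth_mem[of j js] by (auto simp del: nth_mem)
  thus ?thesis using assms by (simp add: col_submatrix_def mat_of_cols_index)
qed

lemma col_submatrix_eq_mat:
  assumes "M \<in> carrier_mat k n" "set js \<subseteq> {0..<n}" "length js = m"
  shows "col_submatrix M js = mat k m (\<lambda>(i, j). M $$ (i, js ! j))"
proof -
  have "col_submatrix M js \<in> carrier_mat k m" using assms by simp
  thus ?thesis using assms(3)
    by (intro eq_matI) (auto simp: col_submatrix_index[OF assms(1,2)])
qed

lemma col_submatrix_mult:
  assumes A: "A \<in> carrier_mat m k" and B: "B \<in> carrier_mat k n" and js: "set js \<subseteq> {0..<n}"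
  shows "col_submatrix (A * B) js = A * col_submatrix B js"
proof -
  have *: "js ! j < n" if "j < length js" for j
    using that js nth_mem[of j js] by (auto simp del: nth_mem)
  show ?thesis using A B *
    by (intro eq_matI)
       (auto simp: col_submatrix_eq_mat[OF mult_carrier_mat[OF A B] js]
          col_submatrix_eq_mat[OF B js] scalar_prod_def intro!: sum.cong)
qed

lemma col_submatrix_map_mat:
  assumes M: "M \<in> carrier_mat k n" and js: "set js \<subseteq> {0..<n}"
  shows "col_submatrix (map_mat f M) js = map_mat f (col_submatrix M js)"
proof -
  have *: "js ! j < n" if "j < length js" for j
    using that js nth_mem[of j js] by (auto simp del: nth_mem)
  have "map_mat f M \<in> carrier_mat k n" using M by simp
  thus ?thesis using M *
    by (intro eq_matI) (auto simp: col_submatrix_eq_mat[OF _ js])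
qed

text \<open>Serves to correct a scalar common to all maximal minors, first over the field and then
  over \<open>R\<close>, by changing a single row.\<close>

lemma det_col_submatrix_multrow:
  fixes M :: "'a::comm_ring_1 mat"
  assumes M: "M \<in> carrier_mat k n" and js: "set js \<subseteq> {0..<n}" "length js = k" and r: "r < k"
  shows "det (col_submatrix (multrow r c M) js) = c * det (col_submatrix M js)"
proof -
  have *: "js ! j < n" if "j < length js" for j
    using that js nth_mem[of j js] by (auto simp del: nth_mem)
  have "multrow r c M \<in> carrier_mat k n" using M by simp
  hence "col_submatrix (multrow r c M) js = multrow r c (col_submatrix M js)" using M * js
    by (intro eq_matI) (auto simp: col_submatrix_eq_mat[OF _ js(1)])
  thus ?thesis using det_multrow[OF r col_submatrix_carrier[OF M js(2)]] by simp
qed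

text \<open>Replacing a column in Cramer's rule and expanding a determinant multilinearly both give
  lists that need not be increasing. A repeated column makes the minor vanish; otherwise sorting
  costs only a sign.\<close>

lemma det_col_submatrix_cases:
  fixes M :: "'a::comm_ring_1 mat"
  assumes M: "M \<in> carrier_mat k n" and js: "set js \<subseteq> {0..<n}" "length js = k"
  obtains (zero) "det (col_submatrix M js) = 0"
  | (choice) js' where "js' \<in> col_choices k n"
      "det (col_submatrix M js) \<in> {det (col_submatrix M js'), - det (col_submatrix M js')}"
proof (cases "distinct js")
  case False
  then obtain i j where ij: "i < k" "j < k" "i \<noteq> j" "js ! i = js ! j"
    using js by (auto simp: distinct_conv_nth)
  have "det (col_submatrix M js) = 0"
    by (rule det_identical_columns[OF col_submatrix_carrier[OF M js(2)] ij(3,1,2)])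
       (use ij js in \<open>auto simp: col_submatrix_eq_mat[OF M js]\<close>)
  thus ?thesis by (rule zero)
next
  case True
  define ks where "ks = sort js"
  have ks: "length ks = k" "set ks \<subseteq> {0..<n}" "ks \<in> col_choices k n"
    using js True by (auto simp: ks_def col_choices_def strict_sorted_iff)
  have "mset js = mset ks" by (simp add: ks_def)
  then obtain p where p: "p permutes {..<length ks}" "permute_list p ks = js"
    by (rule mset_eq_permutation)
  have p': "p permutes {0..<k}" using p(1) ks(1) by (simp add: lessThan_atLeast0)
  have nth: "js ! j = ks ! p j" if "j < k" for j
    using permute_list_nth[OF p(1)] that ks(1) p(2) by auto
  have pk: "p j < k" if "j < k" for j using permutes_in_image[OF p', of j] that by simp
  \<comment> \<open>\<open>det_permute_rows\<close> acts on rows, so the columns are sorted through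
    the transpose.\<close>
  have "det (col_submatrix M js) = det (transpose_mat (col_submatrix M js))"
    by (rule det_transpose[symmetric, OF col_submatrix_carrier[OF M js(2)]])
  also have "transpose_mat (col_submatrix M js) =
      mat k k (\<lambda>(i, j). transpose_mat (col_submatrix M ks) $$ (p i, j))"
    by (intro eq_matI)
       (auto simp: col_submatrix_eq_mat[OF M js] col_submatrix_eq_mat[OF M ks(2,1)] nth pk)
  also have "det \<dots> = signof p * det (transpose_mat (col_submatrix M ks))"
    by (rule det_permute_rows[OF _ p']) (use M ks in simp)
  also have "det (transpose_mat (col_submatrix M ks)) = det (col_submatrix M ks)"
    by (rule det_transpose[OF col_submatrix_carrier[OF M ks(1)]])
  finally have "det (col_submatrix M js) \<in> {det (col_submatrix M ks), - det (col_submatrix M ks)}"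
    by (auto simp: sign_def)
  thus ?thesis by (rule choice[OF ks(3)])
qed

text \<open>Cramer's rule: the entry is the Laplace expansion along column \<open>i\<close> of the
  submatrix whose column \<open>i\<close> was replaced by column \<open>j\<close> of
  \<open>M\<close>. The cofactors agree because they delete the only column that changed.\<close>

lemma adj_mat_mult_index:
  assumes M: "M \<in> carrier_mat k n" and js: "set js \<subseteq> {0..<n}" "length js = k"
    and i: "i < k" and j: "j < n"
  shows "(adj_mat (col_submatrix M js) * M) $$ (i, j) = det (col_submatrix M (list_update js i j))"
proof -
  let ?S = "col_submatrix M js" and ?S' = "col_submatrix M (list_update js i j)"
  have js': "set (list_update js i j) \<subseteq> {0..<n}" "length (list_update js i j) = k"
    using js j set_update_subset_insert[of js i j] by auto
  have S: "?S \<in> carrier_mat k k" and S': "?S' \<in> carrier_mat k k"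
    using M js js' by simp_all
  have del: "mat_delete ?S l i = mat_delete ?S' l i" if "l < k" for l
    using that i by (intro eq_matI)
      (auto simp: mat_delete_def col_submatrix_eq_mat[OF M js] col_submatrix_eq_mat[OF M js'])
  have "(adj_mat ?S * M) $$ (i, j) = (\<Sum>l<k. cofactor ?S l i * M $$ (l, j))"
    using M S i j by (simp add: adj_mat_def scalar_prod_def lessThan_atLeast0)
  also have "\<dots> = (\<Sum>l<k. ?S' $$ (l, i) * cofactor ?S' l i)"
    using i js by (intro sum.cong) (simp_all add: cofactor_def del col_submatrix_eq_mat[OF M js'])
  also have "\<dots> = det ?S'"
    by (rule laplace_expansion_column[symmetric, OF S' i])
  finally show ?thesis .
qed

text \<open>Taking determinants in S adj(S) = det(S) I gives det(S) det(adj(S)) = det(S)^k. Keeping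
  the factor det(S) on the left avoids a cancellation, which may fail over a ring.\<close>

lemma det_col_submatrix_adj_mat_mult:
  assumes M: "M \<in> carrier_mat k n" and ks: "length ks = k"
    and js: "set js \<subseteq> {0..<n}" "length js = k"
  shows "det (col_submatrix M ks) * det (col_submatrix (adj_mat (col_submatrix M ks) * M) js) =
    det (col_submatrix M ks) ^ k * det (col_submatrix M js)"
proof -
  let ?S = "col_submatrix M ks" and ?J = "col_submatrix M js"
  have S: "?S \<in> carrier_mat k k" and J: "?J \<in> carrier_mat k k" using M ks js by auto
  note adj = adj_mat[OF S]
  have "det ?S * det (adj_mat ?S) = det ?S ^ k"
    using det_mult[OF S adj(1)] adj(2) by simp
  thus ?thesis
    by (simp add: col_submatrix_mult[OF adj(1) M js(1)] det_mult[OF adj(1) J] flip: mult.assoc)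
qed

text \<open>Each column of \<open>A * U\<close> is a combination of columns of \<open>A\<close>, and
  the determinant is multilinear in columns. Unlike in the Cauchy-Binet formula, \<open>g\<close>
  ranges over all functions, so repeated and unsorted columns stay in the sum.\<close>

lemma det_mult_expand:
  fixes A :: "'a::comm_ring_1 mat"
  assumes A: "A \<in> carrier_mat k n" and U: "U \<in> carrier_mat n k"
  shows "det (A * U) = (\<Sum>g \<in> {..<k} \<rightarrow>\<^sub>E {..<n}.
    (\<Prod>j<k. U $$ (g j, j)) * det (col_submatrix A (map g [0..<k])))"
proof -
  let ?P = "{p. p permutes {0..<k}}" and ?G = "{..<k} \<rightarrow>\<^sub>E {..<n}"
  have pk: "p j < k" if "p \<in> ?P" "j < k" for p j using permutes_in_image[of p "{0..<k}" j] that by simp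
  have AU: "A * U \<in> carrier_mat k k" using A U by simp
  have "det (A * U) = (\<Sum>p\<in>?P. signof p * (\<Prod>j<k. \<Sum>l<n. A $$ (p j, l) * U $$ (l, j)))"
    unfolding det_col[OF AU] using A U pk
    by (intro sum.cong refl arg_cong2[of _ _ _ _ "(*)"] prod.cong)
       (auto simp: scalar_prod_def lessThan_atLeast0)
  also have "\<dots> = (\<Sum>p\<in>?P. \<Sum>g\<in>?G. signof p * (\<Prod>j<k. A $$ (p j, g j) * U $$ (g j, j)))"
    by (simp add: prod_sum_PiE sum_distrib_left)
  also have "\<dots> = (\<Sum>g\<in>?G. \<Sum>p\<in>?P. signof p * (\<Prod>j<k. A $$ (p j, g j) * U $$ (g j, j)))"
    by (rule sum.swap)
  also have "\<dots> = (\<Sum>g\<in>?G. (\<Prod>j<k. U $$ (g j, j)) * det (col_submatrix A (map g [0..<k])))"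
  proof (rule sum.cong[OF refl])
    fix g assume g: "g \<in> ?G"
    have gs: "set (map g [0..<k]) \<subseteq> {0..<n}" "length (map g [0..<k]) = k" using g by auto
    have "det (col_submatrix A (map g [0..<k])) = (\<Sum>p\<in>?P. signof p * (\<Prod>j<k. A $$ (p j, g j)))"
      unfolding det_col[OF col_submatrix_carrier[OF A gs(2)]]
      by (intro sum.cong refl arg_cong2[of _ _ _ _ "(*)"] prod.cong)
         (use pk in \<open>auto simp: col_submatrix_eq_mat[OF A gs]\<close>)
    thus "(\<Sum>p\<in>?P. signof p * (\<Prod>j<k. A $$ (p j, g j) * U $$ (g j, j))) =
        (\<Prod>j<k. U $$ (g j, j)) * det (col_submatrix A (map g [0..<k]))"
      by (simp add: sum_distrib_left prod.distrib mult_ac)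
  qed
  finally show ?thesis .
qed

section \<open>Representations over the field\<close>

lemma residue_class_hom:
  "residue_class k n \<in> Ring.ring_hom (mpoly_ring (col_choices k n)) (grassmann_ring k n)"
  unfolding residue_class_def[abs_def] grassmann_ring_def
  by (rule ideal.rcos_ring_hom[OF minor_relations_ideal])

lemma residue_class_relation:
  assumes "f \<in> minor_relations k n"
  shows "residue_class k n f = residue_class k n 0"
proof -
  interpret ideal "minor_relations k n" "mpoly_ring (col_choices k n)"
    by (rule minor_relations_ideal)
  have "0 \<in> minor_relations k n" 
    using additive_subgroup.zero_closed[OF is_additive_subgroup] by simp
  thus ?thesis unfolding residue_class_def using assms a_rcos_const by metis
qed

section \<open>Extending a specialization to all polynomials\<close>

lemma mpoly_subst_comm_ring_hom: "comm_ring_hom (mpoly_subst g)"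
  by unfold_locales
     (use mpoly_subst_Const[of g 1] in
       \<open>simp_all add: mpoly_subst_add mpoly_subst_mult mpoly_subst_zero Const_simps\<close>)

text \<open>
  Killing the variables outside \<open>V\<close> retracts all polynomials onto \<open>mpoly_ring V\<close>. This
  turns a homomorphism defined on the carrier only into a total one, to which the matrix library
  applies.
\<close>

definition mpoly_restrict :: "'v set \<Rightarrow> ('v, 'a::comm_ring_1) mpoly \<Rightarrow> ('v, 'a) mpoly" where
  "mpoly_restrict V = mpoly_subst (\<lambda>v. if v \<in> V then Var v else 0)"

lemma mpoly_restrict_closed: "mpoly_restrict V f \<in> carrier (mpoly_ring V)"
  unfolding mpoly_restrict_def
  by (rule mpoly_subst_closed[where V = UNIV]) (auto simp: Var_def)

lemma mpoly_restrict_Var: "v \<in> V \<Longrightarrow> mpoly_restrict V (Var v) = Var v"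
  by (simp add: mpoly_restrict_def mpoly_subst_Var)

lemma specialization_total_hom:
  assumes "specialization k n \<psi>"
  shows "comm_ring_hom (\<lambda>f. \<psi> (residue_class k n (mpoly_restrict (col_choices k n) f)))"
proof -
  let ?T = "mpoly_ring (col_choices k n) :: (nat list, 'a) mpoly ring"
  let ?r = "mpoly_restrict (col_choices k n) :: (nat list, 'a) mpoly \<Rightarrow> _"
  interpret r: comm_ring_hom ?r
    unfolding mpoly_restrict_def by (rule mpoly_subst_comm_ring_hom)
  have hom: "\<psi> \<circ> residue_class k n \<in> Ring.ring_hom ?T (ring_of_type_algebra :: 'a ring)"
    using assms by (intro ring_hom_trans[OF residue_class_hom]) (simp add: specialization_def)
  have const: "\<psi> (residue_class k n (Const c)) = c" for c
    using assms by (simp add: specialization_def)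
  show ?thesis
  proof
    fix f g
    show "\<psi> (residue_class k n (?r (f + g))) = \<psi> (residue_class k n (?r f)) + \<psi> (residue_class k n (?r g))"
      using ring_hom_add[OF hom mpoly_restrict_closed mpoly_restrict_closed, of f g]
      by (simp add: r.hom_add ring_of_type_algebra_def)
    show "\<psi> (residue_class k n (?r (f * g))) = \<psi> (residue_class k n (?r f)) * \<psi> (residue_class k n (?r g))"
      using ring_hom_mult[OF hom mpoly_restrict_closed mpoly_restrict_closed, of f g]
      by (simp add: r.hom_mult ring_of_type_algebra_def)
  qed (use const[of 0] const[of 1] in \<open>simp_all add: Const_simps\<close>)
qed

text \<open>After restriction to the Pluecker coordinates, \<open>q\<close> evaluates a polynomial
  at the generic minors and \<open>h\<close> at the values of \<open>\<psi>\<close>. Identities pass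
  from \<open>q\<close> to \<open>h\<close>, so Cramer's rule for the generic matrix can be
  specialized; the nonzero first minor then allows division.\<close>

lemma specialization_representable:
  fixes \<psi> :: "(nat list, 'a::field) mpoly set \<Rightarrow> 'a"
  assumes k: "1 \<le> k" "k \<le> n" and \<psi>: "specialization k n \<psi>"
    and nz: "\<psi> (plucker_coord k n [0..<k]) \<noteq> 0"
  shows "\<exists>A. represents k n A \<psi>"
proof -
  let ?V = "col_choices k n"
  let ?r = "mpoly_restrict ?V :: (nat list, 'a) mpoly \<Rightarrow> _"
  let ?X = "generic_mat k n :: (nat \<times> nat, 'a) mpoly mat"
  define h where "h f = \<psi> (residue_class k n (?r f))" for f
  define q where "q f = minor_map k n (?r f)" for f
  interpret h: comm_ring_hom h
    unfolding h_def[abs_def] by (rule specialization_total_hom[OF \<psi>])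
  interpret r: comm_ring_hom ?r
    unfolding mpoly_restrict_def by (rule mpoly_subst_comm_ring_hom)
  interpret m: comm_ring_hom "minor_map k n :: (nat list, 'a) mpoly \<Rightarrow> _"
    unfolding minor_map_def by (rule mpoly_subst_comm_ring_hom)
  interpret q: comm_ring_hom q
    by unfold_locales (simp_all add: q_def r.hom_add m.hom_add r.hom_mult m.hom_mult)
  have h_Var: "h (Var js) = \<psi> (plucker_coord k n js)" if "js \<in> ?V" for js
    using that by (simp add: h_def mpoly_restrict_Var plucker_coord_def)
  have q_Var: "q (Var js) = det (col_submatrix ?X js)" if "js \<in> ?V" for js
    using that by (simp add: q_def mpoly_restrict_Var minor_map_def mpoly_subst_Var)
  have h_eq: "h f = h g" if "q f = q g" for f g
  proof -
    have "q (f - g) = 0" using that by (simp add: q.hom_minus)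
    hence "?r (f - g) \<in> minor_relations k n"
      using mpoly_restrict_closed[of ?V "f - g"]
      by (simp add: minor_relations_def a_kernel_def' q_def)
    hence "h (f - g) = h 0" by (simp add: h_def residue_class_relation)
    thus ?thesis by (simp add: h.hom_minus)
  qed
  have X: "?X \<in> carrier_mat k n" by (simp add: generic_mat_def)
  have k0: "[0..<k] \<in> ?V" "set [0..<k] \<subseteq> {0..<n}" "length [0..<k] = k"
    using k by (auto simp: col_choices_def)
  define N where "N = adj_mat (col_submatrix ?X [0..<k]) * ?X"
  have N: "N \<in> carrier_mat k n"
    unfolding N_def using X adj_mat(1)[OF col_submatrix_carrier[OF X k0(3)]] by simp
  \<comment> \<open>Entries of \<open>N\<close> are minors with one column replaced, so each is zero
    or a generic minor up to sign and has a preimage under \<open>q\<close>.\<close>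
  have "\<exists>t. q t = N $$ (i, j)" if ij: "i < k" "j < n" for i j
  proof -
    let ?js = "list_update [0..<k] i j"
    have js: "set ?js \<subseteq> {0..<n}" "length ?js = k"
      using k0 ij set_update_subset_insert[of "[0..<k]" i j] by auto
    have *: "N $$ (i, j) = det (col_submatrix ?X ?js)"
      unfolding N_def by (rule adj_mat_mult_index[OF X k0(2,3) ij])
    show ?thesis
    proof (cases rule: det_col_submatrix_cases[OF X js, case_names zero choice])
      case zero
      thus ?thesis using * q.hom_zero by metis
    next
      case (choice js')
      hence "N $$ (i, j) = q (Var js') \<or> N $$ (i, j) = q (- Var js')"
        using * by (simp add: q_Var q.hom_uminus)
      thus ?thesis by metis
    qed
  qed
  then obtain t where t: "\<And>i j. i < k \<Longrightarrow> j < n \<Longrightarrow> q (t i j) = N $$ (i, j)" by metis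
  define L where "L = mat k n (\<lambda>(i, j). t i j)"
  have L: "L \<in> carrier_mat k n" by (simp add: L_def)
  have qL: "map_mat q L = N" using N by (intro eq_matI) (auto simp: L_def t)
  let ?p = "\<psi> (plucker_coord k n [0..<k])"
  \<comment> \<open>The maximal minors of \<open>map_mat h L\<close> are those prescribed by
    \<open>\<psi>\<close> times \<open>?p ^ k / ?p\<close>; row 0, which exists as
    \<open>1 \<le> k\<close>, absorbs the inverse factor.\<close>
  define A where "A = multrow 0 (?p / ?p ^ k) (map_mat h L)"
  have hL: "map_mat h L \<in> carrier_mat k n" using L by simp
  have "represents k n A \<psi>"
    unfolding represents_def
  proof (intro conjI ballI)
    show "A \<in> carrier_mat k n" using hL by (simp add: A_def)
    fix js assume J: "js \<in> ?V"
    hence js: "set js \<subseteq> {0..<n}" "length js = k" by (auto simp: col_choices_def)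
    \<comment> \<open>Pulling \<open>q\<close> out of determinants turns the adjugate identity for
      \<open>N\<close> into an equality of two values of \<open>q\<close>.\<close>
    have "q (Var [0..<k] * det (col_submatrix L js)) = q (Var [0..<k] ^ k * Var js)"
      using det_col_submatrix_adj_mat_mult[OF X k0(3) js, folded N_def]
      by (simp add: q.hom_mult q.hom_power q_Var k0(1) J col_submatrix_map_mat[OF L js(1)]
          flip: q.hom_det qL)
    from h_eq[OF this] have "?p * det (col_submatrix (map_mat h L) js) = ?p ^ k * \<psi> (plucker_coord k n js)"
      by (simp add: h.hom_mult h.hom_power h_Var k0(1) J col_submatrix_map_mat[OF L js(1)])
    moreover have "0 < k" using k by simp
    ultimately show "det (col_submatrix A js) = \<psi> (plucker_coord k n js)"
      using nz unfolding A_def by (simp add: det_col_submatrix_multrow[OF hL js])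
  qed
  thus ?thesis ..
qed

section \<open>Principal ideal domains inside their fraction field\<close>

context
  fixes R :: "'a::field set"
  assumes pid: "pid_with_fraction_field R"
begin

lemma pid_closed:
  shows pid_zero: "0 \<in> R" and pid_one: "1 \<in> R"
    and pid_add: "x \<in> R \<Longrightarrow> y \<in> R \<Longrightarrow> x + y \<in> R"
    and pid_mult: "x \<in> R \<Longrightarrow> y \<in> R \<Longrightarrow> x * y \<in> R"
    and pid_uminus: "x \<in> R \<Longrightarrow> - x \<in> R"
proof -
  interpret principal_domain "ring_of_type_algebra\<lparr>carrier := R\<rparr>"
    using pid by (simp add: pid_with_fraction_field_def)
  show "0 \<in> R" "1 \<in> R" using zero_closed one_closed by (simp_all add: ring_of_type_algebra_def)
  show "x \<in> R \<Longrightarrow> y \<in> R \<Longrightarrow> x + y \<in> R" "x \<in> R \<Longrightarrow> y \<in> R \<Longrightarrow> x * y \<in> R"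
    using a_closed[of x y] m_closed[of x y] by (simp_all add: ring_of_type_algebra_def)
  show "- x \<in> R" if x: "x \<in> R"
  proof -
    have "\<ominus>\<^bsub>ring_of_type_algebra\<lparr>carrier := R\<rparr>\<^esub> x \<in> R" "\<ominus>\<^bsub>ring_of_type_algebra\<lparr>carrier := R\<rparr>\<^esub> x + x = 0"
      using a_inv_closed[of x] l_neg[of x] x by (simp_all add: ring_of_type_algebra_def)
    thus ?thesis by (metis eq_neg_iff_add_eq_0)
  qed
qed

lemma pid_diff: "x \<in> R \<Longrightarrow> y \<in> R \<Longrightarrow> x - y \<in> R"
  using pid_add[of x "- y"] pid_uminus[of y] by simp

lemma pid_sum: "(\<And>i. i \<in> I \<Longrightarrow> f i \<in> R) \<Longrightarrow> sum f I \<in> R"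
  by (induction I rule: infinite_finite_induct) (auto intro: pid_zero pid_add)

lemma pid_prod: "(\<And>i. i \<in> I \<Longrightarrow> f i \<in> R) \<Longrightarrow> prod f I \<in> R"
  by (induction I rule: infinite_finite_induct) (auto intro: pid_one pid_mult)

text \<open>The ideal generated by \<open>a\<close> and \<open>b\<close> is principal, with
  generator \<open>u * a + v * b\<close>, and \<open>r\<close>, \<open>s\<close> express
  \<open>a\<close>, \<open>b\<close> as its multiples. No division occurs, so
  \<open>a = b = 0\<close> is included.\<close>

lemma pid_bezout:
  assumes a: "a \<in> R" and b: "b \<in> R"
  shows "\<exists>u\<in>R. \<exists>v\<in>R. \<exists>r\<in>R. \<exists>s\<in>R. a = (u * a + v * b) * r \<and> b = (u * a + v * b) * s"
proof -
  let ?R = "ring_of_type_algebra\<lparr>carrier := R\<rparr> :: 'a ring"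
  interpret principal_domain ?R
    using pid by (simp add: pid_with_fraction_field_def)
  define I where "I = {u * a + v * b | u v. u \<in> R \<and> v \<in> R}"
  have II: "u * a + v * b \<in> I" if "u \<in> R" "v \<in> R" for u v using that by (auto simp: I_def)
  have IR: "I \<subseteq> R" using a b by (auto simp: I_def intro: pid_add pid_mult)
  have Iadd: "x + y \<in> I" if xy: "x \<in> I" "y \<in> I" for x y
  proof -
    obtain u v u' v' where "x = u * a + v * b" "y = u' * a + v' * b" "u \<in> R" "v \<in> R" "u' \<in> R" "v' \<in> R"
      using xy by (auto simp: I_def)
    thus ?thesis using II[of "u + u'" "v + v'"] by (simp add: pid_add algebra_simps)
  qed
  have Imult: "x * y \<in> I" if xy: "x \<in> R" "y \<in> I" for x y
  proof -
    obtain u v where "y = u * a + v * b" "u \<in> R" "v \<in> R"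
      using xy by (auto simp: I_def)
    thus ?thesis using II[of "x * u" "x * v"] xy by (simp add: pid_mult algebra_simps)
  qed
  have "ideal I ?R"
  proof (rule idealI[OF ring_axioms])
    show "subgroup I (add_monoid ?R)"
    proof (rule add.subgroupI)
      show "I \<subseteq> carrier ?R" using IR by simp
      show "I \<noteq> {}" using II[OF pid_zero pid_zero] by auto
      fix x assume x: "x \<in> I"
      hence xR: "x \<in> carrier ?R" using IR by auto
      have "\<ominus>\<^bsub>?R\<^esub> x + x = 0" using l_neg[OF xR] by (simp add: ring_of_type_algebra_def)
      hence "\<ominus>\<^bsub>?R\<^esub> x = - 1 * x" by (simp add: eq_neg_iff_add_eq_0)
      moreover have "- 1 * x \<in> I" by (intro Imult x pid_uminus pid_one)
      ultimately show "\<ominus>\<^bsub>?R\<^esub> x \<in> I" by metis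
    next
      fix x y assume "x \<in> I" "y \<in> I"
      thus "x \<oplus>\<^bsub>?R\<^esub> y \<in> I" using Iadd by (simp add: ring_of_type_algebra_def)
    qed
  next
    fix x y assume "x \<in> I" "y \<in> carrier ?R"
    thus "y \<otimes>\<^bsub>?R\<^esub> x \<in> I" "x \<otimes>\<^bsub>?R\<^esub> y \<in> I"
      using Imult[of y x] by (simp_all add: ring_of_type_algebra_def mult.commute)
  qed
  then obtain g where g: "g \<in> carrier ?R" "I = PIdl\<^bsub>?R\<^esub> g" using exists_gen by blast
  have I: "I = {x * g | x. x \<in> R}"
    unfolding g(2) by (simp add: cgenideal_def ring_of_type_algebra_def)
  have "1 * g \<in> I" unfolding I using pid_one by blast
  then obtain u v where uv: "u \<in> R" "v \<in> R" "g = u * a + v * b" by (auto simp: I_def)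
  have "a \<in> I" "b \<in> I" using II[OF pid_one pid_zero] II[OF pid_zero pid_one] by auto
  then obtain r s where "r \<in> R" "s \<in> R" "a = r * g" "b = s * g" by (auto simp: I)
  thus ?thesis using uv by (metis mult.commute)
qed

text \<open>Writing \<open>x\<close> and \<open>y\<close> over a common denominator reduces this to
  the Bezout identity for the numerators.\<close>

lemma fractions_bezout:
  "\<exists>u\<in>R. \<exists>v\<in>R. \<exists>r\<in>R. \<exists>s\<in>R. x = (u * x + v * y) * r \<and> y = (u * x + v * y) * s"
proof -
  obtain a b c d where ab: "a \<in> R" "b \<in> R" "b \<noteq> 0" "x = a / b"
    and cd: "c \<in> R" "d \<in> R" "d \<noteq> 0" "y = c / d"
    using pid unfolding pid_with_fraction_field_def by (metis DiffE singletonI)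
  obtain u v r s where *: "u \<in> R" "v \<in> R" "r \<in> R" "s \<in> R"
    "a * d = (u * (a * d) + v * (c * b)) * r" "c * b = (u * (a * d) + v * (c * b)) * s"
    using pid_bezout[of "a * d" "c * b"] ab cd pid_mult by metis
  have xy: "x = a * d / (b * d)" "y = c * b / (b * d)" using ab cd by simp_all
  have "u * x + v * y = (u * (a * d) + v * (c * b)) / (b * d)"
    unfolding xy by (simp add: add_divide_distrib)
  hence "x = (u * x + v * y) * r" "y = (u * x + v * y) * s"
    using * xy by (metis times_divide_eq_left)+
  thus ?thesis using * by blast
qed

text \<open>Induction on the number of generators of a fractional ideal: the new element is merged
  with the previous generator. The coefficients \<open>u\<close> place the generator in the ideal,
  and \<open>v\<close> shows that it generates.\<close>

lemma fractional_ideal_principal: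
  fixes a :: "nat \<Rightarrow> 'a"
  shows "\<exists>u v. range u \<subseteq> R \<and> range v \<subseteq> R \<and> (\<forall>l<n. a l = (\<Sum>l'<n. a l' * u l') * v l)"
proof (induction n)
  case 0
  show ?case using pid_zero by (intro exI[of _ "\<lambda>_. 0"]) auto
next
  case (Suc n)
  then obtain u v where uv: "range u \<subseteq> R" "range v \<subseteq> R"
    and a: "\<And>l. l < n \<Longrightarrow> a l = (\<Sum>l'<n. a l' * u l') * v l" by blast
  define d where "d = (\<Sum>l'<n. a l' * u l')"
  obtain p q r s where *: "p \<in> R" "q \<in> R" "r \<in> R" "s \<in> R"
    "d = (p * d + q * a n) * r" "a n = (p * d + q * a n) * s"
    using fractions_bezout[of d "a n"] by blast
  \<comment> \<open>The new generator is \<open>p * d + q * a n\<close>, and \<open>d\<close> is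
    \<open>r\<close> times it; hence the factors \<open>p\<close> and \<open>r\<close> on the old
    coefficients.\<close>
  let ?u = "\<lambda>l. if l < n then p * u l else q" and ?v = "\<lambda>l. if l < n then r * v l else s"
  have sum: "(\<Sum>l'<Suc n. a l' * ?u l') = p * d + q * a n"
    by (simp add: d_def sum_distrib_left mult_ac)
  have "range ?u \<subseteq> R" "range ?v \<subseteq> R" using uv * by (auto intro!: pid_mult)
  moreover have "a l = (\<Sum>l'<Suc n. a l' * ?u l') * ?v l" if "l < Suc n" for l
  proof (cases "l < n")
    case True
    hence "a l = d * v l" using a by (simp add: d_def)
    also have "\<dots> = (p * d + q * a n) * r * v l" using *(5) by simp
    finally show ?thesis unfolding sum using True by (simp add: mult.assoc)
  next
    case False
    hence "l = n" using that by simp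
    thus ?thesis unfolding sum using *(6) by simp
  qed
  ultimately show ?case by blast
qed

text \<open>Induction on the number of rows for the \<open>R\<close>-module spanned by the columns.
  Its last coordinates form a principal fractional ideal; lifting a generator to the module and
  subtracting multiples of it leaves vectors with last coordinate zero. The \<open>k\<close>
  generators obtained may be dependent, so no rank is mentioned.\<close>

lemma column_module_free:
  fixes a :: "nat \<Rightarrow> nat \<Rightarrow> 'a"
  shows "\<exists>U V. (\<forall>l m. U l m \<in> R) \<and> (\<forall>m l. V m l \<in> R) \<and>
    (\<forall>i<k. \<forall>l<n. a i l = (\<Sum>m<k. (\<Sum>l'<n. a i l' * U l' m) * V m l))"
proof (induction k arbitrary: a)
  case 0
  show ?case using pid_zero by (intro exI[of _ "\<lambda>_ _. 0"]) auto
next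
  case (Suc k)
  obtain u v where uv: "range u \<subseteq> R" "range v \<subseteq> R"
    and k: "\<And>l. l < n \<Longrightarrow> a k l = (\<Sum>l'<n. a k l' * u l') * v l"
    using fractional_ideal_principal[of n "a k"] by blast
  \<comment> \<open>\<open>w\<close> is the lifted generator; \<open>b\<close> subtracts from each
    column a multiple of \<open>w\<close> with the same last coordinate.\<close>
  define w where "w i = (\<Sum>l'<n. a i l' * u l')" for i
  define b where "b i l = a i l - w i * v l" for i l
  obtain U V where UV: "\<And>l m. U l m \<in> R" "\<And>m l. V m l \<in> R"
    and b: "\<And>i l. i < k \<Longrightarrow> l < n \<Longrightarrow> b i l = (\<Sum>m<k. (\<Sum>l'<n. b i l' * U l' m) * V m l)"
    using Suc[of b] by blast
  have bk: "b k l = 0" if "l < n" for l using k[OF that] by (simp add: b_def w_def)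
  \<comment> \<open>Row \<open>k\<close> of \<open>b\<close> vanishes, so the equation from the
    induction extends to it as \<open>0 = 0\<close>.\<close>
  have b': "b i l = (\<Sum>m<k. (\<Sum>l'<n. b i l' * U l' m) * V m l)" if "i < Suc k" "l < n" for i l
    using b[of i l] bk that by (cases "i = k") simp_all
  \<comment> \<open>Substituting the definition of \<open>b\<close> turns combinations of its
    columns into combinations of columns of \<open>a\<close> with these coefficients; index
    \<open>k\<close> contributes \<open>w\<close>.\<close>
  let ?U = "\<lambda>l m. if m = k then u l else U l m - u l * (\<Sum>l'<n. v l' * U l' m)"
  let ?V = "\<lambda>m. if m = k then v else V m"
  have "?U l m \<in> R" for l m
    using uv UV by (auto intro!: pid_diff pid_mult pid_sum)
  moreover have "?V m l \<in> R" for m l using uv UV by auto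
  moreover have "\<forall>i<Suc k. \<forall>l<n. a i l = (\<Sum>m<Suc k. (\<Sum>l'<n. a i l' * ?U l' m) * ?V m l)"
  proof (intro allI impI)
    fix i l assume il: "i < Suc k" "l < n"
    have "(\<Sum>l'<n. a i l' * ?U l' m) = (\<Sum>l'<n. b i l' * U l' m)" if "m < k" for m
    proof -
      have "(\<Sum>l'<n. a i l' * ?U l' m) =
          (\<Sum>l'<n. a i l' * U l' m) - w i * (\<Sum>l'<n. v l' * U l' m)"
        using that by (simp add: w_def algebra_simps sum_subtractf sum_distrib_right)
      also have "\<dots> = (\<Sum>l'<n. b i l' * U l' m)"
        by (simp add: b_def algebra_simps sum_subtractf sum_distrib_left)
      finally show ?thesis .
    qed
    hence "(\<Sum>m<k. (\<Sum>l'<n. a i l' * ?U l' m) * ?V m l) = b i l"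
      unfolding b'[OF il] by (intro sum.cong) auto
    thus "a i l = (\<Sum>m<Suc k. (\<Sum>l'<n. a i l' * ?U l' m) * ?V m l)"
      by (simp add: w_def[symmetric]) (simp add: b_def)
  qed
  ultimately show ?case by (intro exI[of _ ?U] exI[of _ ?V]) blast
qed

lemma column_module_free_mat:
  assumes A: "A \<in> carrier_mat k n"
  obtains U V where "U \<in> carrier_mat n k" "V \<in> carrier_mat k n"
    "elements_mat U \<subseteq> R" "elements_mat V \<subseteq> R" "A = A * U * V"
proof -
  obtain U V where UV: "\<And>l m. U l m \<in> R" "\<And>m l. V m l \<in> R"
    and eq: "\<And>i l. i < k \<Longrightarrow> l < n \<Longrightarrow>
      A $$ (i, l) = (\<Sum>m<k. (\<Sum>l'<n. A $$ (i, l') * U l' m) * V m l)"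
    using column_module_free[of k n "\<lambda>i l. A $$ (i, l)"] by blast
  show ?thesis
  proof (rule that[of "mat n k (\<lambda>(l, m). U l m)" "mat k n (\<lambda>(m, l). V m l)"])
    show "A = A * mat n k (\<lambda>(l, m). U l m) * mat k n (\<lambda>(m, l). V m l)"
      using A by (intro eq_matI) (auto simp: scalar_prod_def eq lessThan_atLeast0 intro!: sum.cong)
  qed (use UV in \<open>auto simp: elements_mat_def\<close>)
qed

text \<open>The expansion is an \<open>R\<close>-combination of minors of \<open>A\<close>; a list
  that is not increasing gives zero or, up to sign, a minor known to lie in
  \<open>R\<close>.\<close>

lemma det_mult_mem:
  assumes A: "A \<in> carrier_mat k n" and U: "U \<in> carrier_mat n k" "elements_mat U \<subseteq> R"
    and minors: "\<And>js. js \<in> col_choices k n \<Longrightarrow> det (col_submatrix A js) \<in> R"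
  shows "det (A * U) \<in> R"
  unfolding det_mult_expand[OF A U(1)]
proof (intro pid_sum pid_mult pid_prod)
  fix g assume g: "g \<in> {..<k} \<rightarrow>\<^sub>E {..<n}"
  have js: "set (map g [0..<k]) \<subseteq> {0..<n}" "length (map g [0..<k]) = k" using g by auto
  show "det (col_submatrix A (map g [0..<k])) \<in> R"
    by (cases rule: det_col_submatrix_cases[OF A js]) (use minors pid_zero pid_uminus in auto)
  fix j assume "j \<in> {..<k}"
  hence "g j < n" "j < k" using g by auto
  thus "U $$ (g j, j) \<in> R" using U by auto
qed

end

section \<open>Passage from the field to \<open>R\<close>\<close>

theorem theorem3p7:
  fixes R :: "'a::field set" and k n :: nat
    and \<psi> :: "(nat list, 'a) mpoly set \<Rightarrow> 'a"
  assumes "pid_with_fraction_field R"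
    and "1 \<le> k" and "k \<le> n"
    and "specialization k n \<psi>"
    and "\<forall>js \<in> col_choices k n. \<psi> (plucker_coord k n js) \<in> R - {0}"
  shows "\<exists>M. elements_mat M \<subseteq> R \<and> represents k n M \<psi>"
proof -
  have "[0..<k] \<in> col_choices k n" using assms(3) by (auto simp: col_choices_def)
  hence "\<psi> (plucker_coord k n [0..<k]) \<noteq> 0" using assms(5) by blast
  then obtain A where "represents k n A \<psi>"
    using specialization_representable[OF assms(2-4)] by blast
  hence A: "A \<in> carrier_mat k n"
    and minors: "\<And>js. js \<in> col_choices k n \<Longrightarrow> det (col_submatrix A js) = \<psi> (plucker_coord k n js)"
    by (auto simp: represents_def)
  obtain U V where U: "U \<in> carrier_mat n k" "elements_mat U \<subseteq> R"
    and V: "V \<in> carrier_mat k n" "elements_mat V \<subseteq> R" and AUV: "A = A * U * V"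
    using column_module_free_mat[OF assms(1) A] by metis
  \<comment> \<open>By \<open>A = A * U * V\<close>, each maximal minor of \<open>A\<close> is
    \<open>c\<close> times that of \<open>V\<close>, so scaling row 0 of \<open>V\<close> by
    \<open>c\<close> recovers the minors of \<open>A\<close>.\<close>
  define c where "c = det (A * U)"
  have c: "c \<in> R"
    unfolding c_def using det_mult_mem[OF assms(1) A U] minors assms(5) by simp
  have AU: "A * U \<in> carrier_mat k k" using A U by simp
  have "elements_mat (multrow 0 c V) \<subseteq> R"
  proof
    fix x assume "x \<in> elements_mat (multrow 0 c V)"
    then obtain i j where "i < k" "j < n" "x = (if i = 0 then c * V $$ (i, j) else V $$ (i, j))"
      using V by (auto dest!: elements_matD)
    moreover have "V $$ (i, j) \<in> R" using V calculation by auto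
    ultimately show "x \<in> R" using c pid_mult[OF assms(1)] by auto
  qed
  moreover have "represents k n (multrow 0 c V) \<psi>"
    unfolding represents_def
  proof (intro conjI ballI)
    show "multrow 0 c V \<in> carrier_mat k n" using V by simp
    fix js assume J: "js \<in> col_choices k n"
    hence js: "set js \<subseteq> {0..<n}" "length js = k" by (auto simp: col_choices_def)
    have "det (col_submatrix (multrow 0 c V) js) = c * det (col_submatrix V js)"
      by (rule det_col_submatrix_multrow[OF V(1) js]) (use assms(2) in simp)
    also have "\<dots> = det (A * U * col_submatrix V js)"
      unfolding c_def by (rule det_mult[symmetric, OF AU col_submatrix_carrier[OF V(1) js(2)]])
    also have "A * U * col_submatrix V js = col_submatrix (A * U * V) js"
      by (rule col_submatrix_mult[symmetric, OF AU V(1) js(1)])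
    also have "\<dots> = col_submatrix A js" using AUV by simp
    also have "det \<dots> = \<psi> (plucker_coord k n js)" by (rule minors[OF J])
    finally show "det (col_submatrix (multrow 0 c V) js) = \<psi> (plucker_coord k n js)" .
  qed
  ultimately show ?thesis by blast
qed

end
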